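(* Let $U$ be an ultraextensive metric space and $X\subseteq U$ a countable subset. Then there exists a countable subset $Y\subseteq U$ with $X\subseteq Y$ such that $Y$, with the metric inherited from $U$, is ultraextensive.
   Context: A metric space $Y$ extends $X$ if $X\subseteq Y$ and $d_Y$ restricted to $X$ equals $d_X$. A partial isometry of a metric space $X$ is an isometry between two finite subsets of $X$; $\mathcal{P}_X$ denotes the set of partial isometries $p$ of $X$ which are not restrictions of the identity. For a finite metric space $X$, an S-extension of $X$ is a pair $(Y,\phi)$ where $Y$ is a metric space extending $X$ and $\phi:\mathcal{P}_X\to\mathrm{Iso}(Y)$ satisfies $\phi(p)\restriction\mathrm{dom}(p)=p$ for all $p\in\mathcal{P}_X$; we assume $\phi(p^{-1})=\phi(p)^{-1}$ and extend $\phi$ to a group homomorphism from the free group $\mathbb{F}(\mathcal{P}_X)$ (on generators $\mathcal{P}_X$, with $p^{-1}$ identified with the formal inverse of $p$) to $\mathrm{Iso}(Y)$. $(Y,\phi)$ is minimal if every $y\in Y$ equals $\phi(g)(x)$ for some $g\in\mathbb{F}(\mathcal{P}_X)$ and $x\in X$. If $X_1\subseteq X_2$ are finite and $(Y_i,\phi_i)$ is an S-extension of $X_i$, they are coherent if (i) $Y_2$ extends $Y_1$, (ii) $\phi_2(p)$ extends $\phi_1(p)$ for all $p\in\mathcal{P}_{X_1}$, and (iii) letting $K_i=\phi_i(\mathbb{F}(\mathcal{P}_{X_i}))$, the assignment $\phi_1(p)\mapsto\phi_2(p)$ ($p\in\mathcal{P}_{X_1}$) extends uniquely to an injective group homomorphism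 $K_1\to K_2$. A metric space $U$ is ultraextensive if: (i) every partial isometry of $U$ extends to an isometry of $U$; (ii) every finite $X\subseteq U$ has a finite S-extension $(Y,\phi)$ with $Y\subseteq U$; (iii) whenever $X_1\subseteq X_2\subseteq U$ are finite and $(Y_1,\phi_1)$ is a finite minimal S-extension of $X_1$ with $Y_1\subseteq U$, there is a finite minimal S-extension $(Y_2,\phi_2)$ of $X_2$ with $Y_2\subseteq U$ coherent with $(Y_1,\phi_1)$. *)

theory Defs
  imports "HOL-Analysis.Abstract_Metric_Spaces" "HOL-Algebra.Bij" "HOL-Library.Countable_Set"
begin

section \<open>Isometries and partial isometries\<close>

definition metric_extends :: "'a metric \<Rightarrow> 'a metric \<Rightarrow> bool" where
  "metric_extends Y X \<longleftrightarrow>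
     mspace X \<subseteq> mspace Y \<and> (\<forall>x\<in>mspace X. \<forall>y\<in>mspace X. mdist Y x y = mdist X x y)"

definition isometry :: "'a metric \<Rightarrow> 'b metric \<Rightarrow> ('a \<Rightarrow> 'b) \<Rightarrow> bool" where
  "isometry M N f \<longleftrightarrow>
     bij_betw f (mspace M) (mspace N) \<and>
     (\<forall>x\<in>mspace M. \<forall>y\<in>mspace M. mdist N (f x) (f y) = mdist M x y)"

text \<open>The group of isometries of a metric space onto itself, as a subgroup of the symmetric group.
  As for \<^const>\<open>BijGroup\<close>, its elements are \<^const>\<open>undefined\<close> outside the space.\<close>

definition Iso :: "'a metric \<Rightarrow> ('a \<Rightarrow> 'a) monoid" where
  "Iso Y = (BijGroup (mspace Y)) \<lparr>carrier := {f \<in> Bij (mspace Y). isometry Y Y f}\<rparr>"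

definition partial_isometries :: "'a metric \<Rightarrow> ('a \<rightharpoonup> 'a) set" where
  "partial_isometries X =
     {p. finite (dom p) \<and> dom p \<subseteq> mspace X \<and> ran p \<subseteq> mspace X \<and>
         isometry (submetric X (dom p)) (submetric X (ran p)) (the \<circ> p)}"

text \<open>The set written \<open>\<P>\<^sub>X\<close>; \<^term>\<open>Some\<close> is the identity as a partial function.\<close>

definition PIso :: "'a metric \<Rightarrow> ('a \<rightharpoonup> 'a) set" where
  "PIso X = {p \<in> partial_isometries X. \<not> p \<subseteq>\<^sub>m Some}"

definition pmap_inv :: "('a \<rightharpoonup> 'b) \<Rightarrow> ('b \<rightharpoonup> 'a)" where
  "pmap_inv p = (\<lambda>y. if y \<in> ran p then Some (THE x. p x = Some y) else None)"

section \<open>The free group\<close>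

text \<open>Words over \<open>S\<close> modulo cancellation of \<open>s\<close> against \<open>i s\<close>, where the involution \<open>i\<close> of \<open>S\<close> names
  the formal inverse of each generator. A generator with \<open>i s = s\<close> thus becomes an
  element of order two; on \<open>\<P>\<^sub>X\<close> this happens for the self-inverse partial isometries.\<close>

inductive_set word_eq :: "'s set \<Rightarrow> ('s \<Rightarrow> 's) \<Rightarrow> ('s list \<times> 's list) set"
  for S :: "'s set" and i :: "'s \<Rightarrow> 's" where
  refl: "w \<in> lists S \<Longrightarrow> (w, w) \<in> word_eq S i"
| cancel: "u \<in> lists S \<Longrightarrow> v \<in> lists S \<Longrightarrow> s \<in> S \<Longrightarrow> (u @ [s, i s] @ v, u @ v) \<in> word_eq S i"
| sym: "(u, v) \<in> word_eq S i \<Longrightarrow> (v, u) \<in> word_eq S i"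
| trans: "(u, v) \<in> word_eq S i \<Longrightarrow> (v, w) \<in> word_eq S i \<Longrightarrow> (u, w) \<in> word_eq S i"

definition free_group :: "'s set \<Rightarrow> ('s \<Rightarrow> 's) \<Rightarrow> 's list set monoid" where
  "free_group S i =
     \<lparr>carrier = lists S // word_eq S i,
      mult = (\<lambda>g h. word_eq S i `` {u @ v | u v. u \<in> g \<and> v \<in> h}),
      one = word_eq S i `` {[]}\<rparr>"

definition word_val :: "('g, 'm) monoid_scheme \<Rightarrow> ('s \<Rightarrow> 'g) \<Rightarrow> 's list \<Rightarrow> 'g" where
  "word_val G \<phi> w = foldr (\<lambda>s x. \<phi> s \<otimes>\<^bsub>G\<^esub> x) w \<one>\<^bsub>G\<^esub>"

text \<open>The homomorphism from the free group to \<open>G\<close> extending \<open>\<phi>\<close>. The value does not depend on the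
  word chosen in the class when \<open>\<phi>\<close> turns formal inverses into inverses; see
  \<open>free_lift_hom\<close>, \<open>free_lift_generator\<close> and \<open>free_lift_unique\<close>.\<close>

definition free_lift :: "('g, 'm) monoid_scheme \<Rightarrow> ('s \<Rightarrow> 'g) \<Rightarrow> 's list set \<Rightarrow> 'g" where
  "free_lift G \<phi> g = the_elem (word_val G \<phi> ` g)"

section \<open>S-extensions\<close>

definition FPIso :: "'a metric \<Rightarrow> ('a \<rightharpoonup> 'a) list set monoid" where
  "FPIso X = free_group (PIso X) pmap_inv"

definition S_extension :: "'a metric \<Rightarrow> 'a metric \<Rightarrow> (('a \<rightharpoonup> 'a) \<Rightarrow> 'a \<Rightarrow> 'a) \<Rightarrow> bool" where
  "S_extension X Y \<phi> \<longleftrightarrow>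
     finite (mspace X) \<and> metric_extends Y X \<and>
     \<phi> \<in> PIso X \<rightarrow> carrier (Iso Y) \<and>
     (\<forall>p\<in>PIso X. \<forall>x\<in>dom p. p x = Some (\<phi> p x)) \<and>
     (\<forall>p\<in>PIso X. \<phi> (pmap_inv p) = inv\<^bsub>Iso Y\<^esub> (\<phi> p))"

definition minimal_S_extension ::
    "'a metric \<Rightarrow> 'a metric \<Rightarrow> (('a \<rightharpoonup> 'a) \<Rightarrow> 'a \<Rightarrow> 'a) \<Rightarrow> bool" where
  "minimal_S_extension X Y \<phi> \<longleftrightarrow>
     S_extension X Y \<phi> \<and>
     (\<forall>y\<in>mspace Y. \<exists>g\<in>carrier (FPIso X). \<exists>x\<in>mspace X. y = free_lift (Iso Y) \<phi> g x)"

definition S_image ::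
    "'a metric \<Rightarrow> 'a metric \<Rightarrow> (('a \<rightharpoonup> 'a) \<Rightarrow> 'a \<Rightarrow> 'a) \<Rightarrow> ('a \<Rightarrow> 'a) monoid" where
  "S_image X Y \<phi> = (Iso Y) \<lparr>carrier := free_lift (Iso Y) \<phi> ` carrier (FPIso X)\<rparr>"

text \<open>Coherence is only used for S-extensions of \<open>X1\<close> and \<open>X2\<close> where \<open>X2\<close> extends \<open>X1\<close>.
  Extensionality of \<open>h\<close> makes uniqueness mean uniqueness as a map on the group.\<close>

definition coherent ::
    "'a metric \<Rightarrow> 'a metric \<Rightarrow> (('a \<rightharpoonup> 'a) \<Rightarrow> 'a \<Rightarrow> 'a) \<Rightarrow>
     'a metric \<Rightarrow> 'a metric \<Rightarrow> (('a \<rightharpoonup> 'a) \<Rightarrow> 'a \<Rightarrow> 'a) \<Rightarrow> bool" where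
  "coherent X1 Y1 \<phi>1 X2 Y2 \<phi>2 \<longleftrightarrow>
     metric_extends Y2 Y1 \<and>
     (\<forall>p\<in>PIso X1. \<forall>y\<in>mspace Y1. \<phi>2 p y = \<phi>1 p y) \<and>
     (\<exists>!h. h \<in> hom (S_image X1 Y1 \<phi>1) (S_image X2 Y2 \<phi>2) \<and>
           h \<in> extensional (carrier (S_image X1 Y1 \<phi>1)) \<and>
           inj_on h (carrier (S_image X1 Y1 \<phi>1)) \<and>
           (\<forall>p\<in>PIso X1. h (\<phi>1 p) = \<phi>2 p))"

definition ultraextensive :: "'a metric \<Rightarrow> bool" where
  "ultraextensive U \<longleftrightarrow>
     (\<forall>p\<in>partial_isometries U. \<exists>f\<in>carrier (Iso U). \<forall>x\<in>dom p. p x = Some (f x)) \<and>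
     (\<forall>X. finite X \<and> X \<subseteq> mspace U \<longrightarrow>
        (\<exists>Y \<phi>. Y \<subseteq> mspace U \<and> finite Y \<and> S_extension (submetric U X) (submetric U Y) \<phi>)) \<and>
     (\<forall>X1 X2 Y1 \<phi>1.
        finite X1 \<and> finite X2 \<and> X1 \<subseteq> X2 \<and> X2 \<subseteq> mspace U \<and>
        Y1 \<subseteq> mspace U \<and> finite Y1 \<and>
        minimal_S_extension (submetric U X1) (submetric U Y1) \<phi>1 \<longrightarrow>
        (\<exists>Y2 \<phi>2. Y2 \<subseteq> mspace U \<and> finite Y2 \<and>
           minimal_S_extension (submetric U X2) (submetric U Y2) \<phi>2 \<and>
           coherent (submetric U X1) (submetric U Y1) \<phi>1 (submetric U X2) (submetric U Y2) \<phi>2))"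

section \<open>Basic facts\<close>

subsection \<open>The free group\<close>

lemma word_eq_lists:
  assumes i: "i \<in> S \<rightarrow> S" and "(u, v) \<in> word_eq S i"
  shows "u \<in> lists S \<and> v \<in> lists S"
  using assms(2) by induction (use i in auto)

lemma equiv_word_eq:
  assumes "i \<in> S \<rightarrow> S"
  shows "equiv (lists S) (word_eq S i)"
proof (rule equivI)
  show "word_eq S i \<subseteq> lists S \<times> lists S"
    using word_eq_lists[OF assms] by auto
  show "refl_on (lists S) (word_eq S i)"
    by (auto simp: refl_on_def intro: word_eq.refl)
  show "Relation.sym (word_eq S i)"
    by (auto simp: Relation.sym_def intro: word_eq.sym)
  show "Relation.trans (word_eq S i)"
    unfolding Relation.trans_def by (blast intro: word_eq.trans)
qed

lemma word_eq_append_left: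
  assumes "(u, v) \<in> word_eq S i" "w \<in> lists S"
  shows "(w @ u, w @ v) \<in> word_eq S i"
  using assms(1)
proof induction
  case (cancel u v s)
  then show ?case
    using assms(2) word_eq.cancel[of "w @ u" S v s i] by simp
next
  case (refl u)
  then show ?case
    using assms(2) by (intro word_eq.refl) simp
qed (auto intro: word_eq.sym word_eq.trans)

lemma word_eq_append_right:
  assumes "(u, v) \<in> word_eq S i" "w \<in> lists S"
  shows "(u @ w, v @ w) \<in> word_eq S i"
  using assms(1)
proof induction
  case (cancel u v s)
  then show ?case
    using assms(2) word_eq.cancel[of u S "v @ w" s i] by simp
next
  case (refl u)
  then show ?case
    using assms(2) by (intro word_eq.refl) simp
qed (auto intro: word_eq.sym word_eq.trans)

lemma free_group_mult_class:
  assumes i: "i \<in> S \<rightarrow> S" and "u \<in> lists S" "v \<in> lists S"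
  shows "(word_eq S i `` {u}) \<otimes>\<^bsub>free_group S i\<^esub> (word_eq S i `` {v}) = word_eq S i `` {u @ v}"
proof -
  have "(u @ v, u' @ v') \<in> word_eq S i"
    if "(u, u') \<in> word_eq S i" "(v, v') \<in> word_eq S i" for u' v'
    using word_eq_append_right[OF that(1) assms(3)] word_eq_append_left[OF that(2)]
      word_eq_lists[OF i that(1)] by (blast intro: word_eq.trans)
  moreover have "(u, u) \<in> word_eq S i" "(v, v) \<in> word_eq S i"
    using assms by (auto intro: word_eq.refl)
  ultimately show ?thesis
    unfolding free_group_def by (auto intro: word_eq.trans)
qed

lemma free_group_carrierE:
  assumes "g \<in> carrier (free_group S i)"
  obtains w where "w \<in> lists S" "g = word_eq S i `` {w}"
  using assms by (auto simp: free_group_def quotient_def)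

lemma class_in_free_group [simp]:
  "w \<in> lists S \<Longrightarrow> word_eq S i `` {w} \<in> carrier (free_group S i)"
  by (simp add: free_group_def quotientI)

lemma word_eq_inverse:
  assumes i: "i \<in> S \<rightarrow> S" "\<forall>s\<in>S. i (i s) = s" and "w \<in> lists S"
  shows "(rev (map i w) @ w, []) \<in> word_eq S i"
  using assms(3)
proof (induction w)
  case (Cons s w)
  then have w: "rev (map i w) \<in> lists S" "w \<in> lists S" "i s \<in> S" "i (i s) = s"
    using i by (auto simp: lists_eq_set)
  have "(rev (map i w) @ [i s, s] @ w, rev (map i w) @ w) \<in> word_eq S i"
    using word_eq.cancel[OF w(1,2,3), of i] w(4) by simp
  then show ?case
    using Cons by (auto intro: word_eq.trans)
qed (auto intro: word_eq.refl)

lemma group_free_group: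
  assumes i: "i \<in> S \<rightarrow> S" "\<forall>s\<in>S. i (i s) = s"
  shows "group (free_group S i)"
proof (rule groupI)
  have one: "\<one>\<^bsub>free_group S i\<^esub> = word_eq S i `` {[]}"
    by (simp add: free_group_def)
  show "\<one>\<^bsub>free_group S i\<^esub> \<in> carrier (free_group S i)"
    by (simp add: one)
  fix x assume "x \<in> carrier (free_group S i)"
  then obtain u where u: "u \<in> lists S" "x = word_eq S i `` {u}"
    by (rule free_group_carrierE)
  show "\<one>\<^bsub>free_group S i\<^esub> \<otimes>\<^bsub>free_group S i\<^esub> x = x"
    using free_group_mult_class[OF i(1) _ u(1), of "[]"] by (simp add: one u)
  have *: "rev (map i u) \<in> lists S"
    using u i by (auto simp: lists_eq_set)
  have "(word_eq S i `` {rev (map i u)}) \<otimes>\<^bsub>free_group S i\<^esub> x = \<one>\<^bsub>free_group S i\<^esub>"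
    unfolding u(2) one free_group_mult_class[OF i(1) * u(1)]
    using equiv_class_eq[OF equiv_word_eq[OF i(1)] word_eq_inverse[OF i u(1)]] .
  with * show "\<exists>y\<in>carrier (free_group S i). y \<otimes>\<^bsub>free_group S i\<^esub> x = \<one>\<^bsub>free_group S i\<^esub>"
    by (meson class_in_free_group)
  fix y assume "y \<in> carrier (free_group S i)"
  then obtain v where v: "v \<in> lists S" "y = word_eq S i `` {v}"
    by (rule free_group_carrierE)
  show "x \<otimes>\<^bsub>free_group S i\<^esub> y \<in> carrier (free_group S i)"
    using u v by (simp add: free_group_mult_class[OF i(1)])
  fix z assume "z \<in> carrier (free_group S i)"
  then obtain w where w: "w \<in> lists S" "z = word_eq S i `` {w}"
    by (rule free_group_carrierE)
  show "x \<otimes>\<^bsub>free_group S i\<^esub> y \<otimes>\<^bsub>free_group S i\<^esub> z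
      = x \<otimes>\<^bsub>free_group S i\<^esub> (y \<otimes>\<^bsub>free_group S i\<^esub> z)"
    using u v w by (simp add: free_group_mult_class[OF i(1)])
qed

subsection \<open>The universal property\<close>

context
  fixes G :: "('g, 'm) monoid_scheme" (structure) and S :: "'s set" and i \<phi>
  assumes G: "group G" and i: "i \<in> S \<rightarrow> S" "\<forall>s\<in>S. i (i s) = s"
    and \<phi>: "\<phi> \<in> S \<rightarrow> carrier G" "\<forall>s\<in>S. \<phi> (i s) = inv (\<phi> s)"
begin

interpretation group G by (rule G)

lemma word_val_closed: "w \<in> lists S \<Longrightarrow> word_val G \<phi> w \<in> carrier G"
  by (induction w) (use \<phi> in \<open>auto simp: word_val_def\<close>)

lemma word_val_append:
  assumes "u \<in> lists S" "v \<in> lists S"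
  shows "word_val G \<phi> (u @ v) = word_val G \<phi> u \<otimes> word_val G \<phi> v"
  using assms(1)
proof (induction u)
  case Nil
  then show ?case
    using word_val_closed[OF assms(2)] by (simp add: word_val_def)
next
  case (Cons s u)
  then have "\<phi> s \<in> carrier G" "word_val G \<phi> u \<in> carrier G" "word_val G \<phi> v \<in> carrier G"
    using \<phi>(1) word_val_closed assms(2) by auto
  then show ?case
    using Cons by (simp add: word_val_def m_assoc)
qed

lemma word_val_cong:
  assumes "(u, v) \<in> word_eq S i"
  shows "word_val G \<phi> u = word_val G \<phi> v"
  using assms
proof induction
  case (cancel u v s)
  have *: "word_val G \<phi> [s, i s] = \<one>"
    using cancel \<phi> by (simp add: word_val_def Pi_iff)
  have "[s, i s] \<in> lists S" "[s, i s] @ v \<in> lists S"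
    using cancel i by auto
  then show ?case
    using cancel * word_val_closed by (simp add: word_val_append del: append_Cons)
qed auto

lemma free_lift_class:
  assumes "w \<in> lists S"
  shows "free_lift G \<phi> (word_eq S i `` {w}) = word_val G \<phi> w"
proof -
  have "word_val G \<phi> ` (word_eq S i `` {w}) = {word_val G \<phi> w}"
    using word_val_cong word_eq.refl[OF assms] by force
  then show ?thesis
    by (simp add: free_lift_def)
qed

lemma free_lift_hom: "free_lift G \<phi> \<in> hom (free_group S i) G"
proof (rule homI)
  fix x assume "x \<in> carrier (free_group S i)"
  then obtain u where u: "u \<in> lists S" "x = word_eq S i `` {u}"
    by (rule free_group_carrierE)
  show "free_lift G \<phi> x \<in> carrier G"
    using u by (simp add: free_lift_class word_val_closed)
  fix y assume "y \<in> carrier (free_group S i)"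
  then obtain v where v: "v \<in> lists S" "y = word_eq S i `` {v}"
    by (rule free_group_carrierE)
  show "free_lift G \<phi> (x \<otimes>\<^bsub>free_group S i\<^esub> y) = free_lift G \<phi> x \<otimes> free_lift G \<phi> y"
    using u v by (simp add: free_group_mult_class[OF i(1)] free_lift_class word_val_append)
qed

lemma free_lift_generator:
  assumes "s \<in> S"
  shows "free_lift G \<phi> (word_eq S i `` {[s]}) = \<phi> s"
  proof -
  have "\<phi> s \<in> carrier G"
    using assms \<phi>(1) by auto
  then show ?thesis
    using assms by (simp add: free_lift_class word_val_def)
qed

lemma free_lift_unique:
  assumes h: "h \<in> hom (free_group S i) G"
    and gen: "\<forall>s\<in>S. h (word_eq S i `` {[s]}) = \<phi> s"
    and g: "g \<in> carrier (free_group S i)"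
  shows "h g = free_lift G \<phi> g"
proof -
  obtain w where w: "w \<in> lists S" "g = word_eq S i `` {w}"
    using g by (rule free_group_carrierE)
  have "h (word_eq S i `` {w}) = word_val G \<phi> w"
    using w(1)
  proof (induction w)
    case Nil
    have "h \<one>\<^bsub>free_group S i\<^esub> = \<one>"
      using hom_one[OF h group_free_group[OF i] G] .
    then show ?case
      by (simp add: word_val_def free_group_def)
  next
    case (Cons s w)
    then have "h (word_eq S i `` {[s] @ w})
        = h (word_eq S i `` {[s]}) \<otimes> h (word_eq S i `` {w})"
      using hom_mult[OF h, of "word_eq S i `` {[s]}" "word_eq S i `` {w}"]
      by (simp add: free_group_mult_class[OF i(1)])
    then show ?case
      using Cons gen by (simp add: word_val_def)
  qed
  then show ?thesis
    using w by (simp add: free_lift_class)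
qed

end

subsection \<open>Isometry groups and inverses of partial isometries\<close>

lemma group_Iso: "group (Iso Y)"
proof -
  let ?B = "BijGroup (mspace Y)"
  interpret B: group ?B by (rule group_BijGroup)
  have "subgroup {f \<in> Bij (mspace Y). isometry Y Y f} ?B"
  proof (rule B.subgroupI)
    show "{f \<in> Bij (mspace Y). isometry Y Y f} \<subseteq> carrier ?B"
      by (auto simp: BijGroup_def)
    have "(\<lambda>x\<in>mspace Y. x) \<in> {f \<in> Bij (mspace Y). isometry Y Y f}"
      using id_Bij by (auto simp: isometry_def Bij_def)
    then show "{f \<in> Bij (mspace Y). isometry Y Y f} \<noteq> {}"
      by blast
  next
    fix f assume f: "f \<in> {f \<in> Bij (mspace Y). isometry Y Y f}"
    let ?g = "\<lambda>x\<in>mspace Y. inv_into (mspace Y) f x"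
    have fi: "f (inv_into (mspace Y) f x) = x" "inv_into (mspace Y) f x \<in> mspace Y"
      if "x \<in> mspace Y" for x
      using f that by (auto simp: Bij_def bij_betw_def f_inv_into_f inv_into_into)
    have "?g \<in> Bij (mspace Y)"
      using f restrict_inv_into_Bij by auto
    moreover have "mdist Y (?g x) (?g y) = mdist Y x y"
      if "x \<in> mspace Y" "y \<in> mspace Y" for x y
      using f fi[OF that(1)] fi[OF that(2)] that by (auto simp: isometry_def) metis
    ultimately show "inv\<^bsub>?B\<^esub> f \<in> {f \<in> Bij (mspace Y). isometry Y Y f}"
      using f by (auto simp: inv_BijGroup isometry_def Bij_def)
  next
    fix f g
    assume fg: "f \<in> {f \<in> Bij (mspace Y). isometry Y Y f}"
      "g \<in> {f \<in> Bij (mspace Y). isometry Y Y f}"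
    then have "compose (mspace Y) f g \<in> Bij (mspace Y)" "g \<in> mspace Y \<rightarrow> mspace Y"
      by (auto intro: compose_Bij dest: Bij_imp_funcset)
    with fg show "f \<otimes>\<^bsub>?B\<^esub> g \<in> {f \<in> Bij (mspace Y). isometry Y Y f}"
      by (auto simp: BijGroup_def isometry_def Bij_def compose_eq Pi_iff)
  qed
  then show ?thesis
    unfolding Iso_def by (rule B.subgroup_imp_group)
qed

lemma partial_isometry_inj:
  assumes "p \<in> partial_isometries X" "p x = Some y" "p x' = Some y"
  shows "x = x'"
proof -
  have "inj_on (the \<circ> p) (dom p)"
    using assms(1) by (auto simp: partial_isometries_def isometry_def bij_betw_def Int_absorb2)
  then show ?thesis
    using assms by (auto simp: inj_on_def dom_def)
qed

lemma pmap_inv_eq_Some_iff: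
  assumes "p \<in> partial_isometries X"
  shows "pmap_inv p y = Some x \<longleftrightarrow> p x = Some y"
proof -
  have "(THE x. p x = Some y) = x" if "p x = Some y" for x
    using that partial_isometry_inj[OF assms] by blast
  then show ?thesis
    by (auto simp: pmap_inv_def ran_def)
qed

lemma pmap_inv_partial_isometry:
  assumes p: "p \<in> partial_isometries X"
  shows "pmap_inv p \<in> partial_isometries X" "pmap_inv (pmap_inv p) = p"
proof -
  note [simp] = pmap_inv_eq_Some_iff[OF p]
  have dr: "dom (pmap_inv p) = ran p" "ran (pmap_inv p) = dom p"
    by (auto simp: dom_def ran_def)
  have d: "mdist X y y' = mdist X x x'" if "p x = Some y" "p x' = Some y'" for x y x' y'
  proof -
    have "x \<in> dom p \<inter> mspace X" "x' \<in> dom p \<inter> mspace X"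
      using p that by (auto simp: partial_isometries_def)
    then have "mdist X (the (p x)) (the (p x')) = mdist X x x'"
      using p by (simp add: partial_isometries_def isometry_def)
    then show ?thesis
      using that by simp
  qed
  have sub: "dom p \<subseteq> mspace X" "ran p \<subseteq> mspace X" "finite (dom p)"
    using p by (auto simp: partial_isometries_def)
  have bij: "bij_betw (the \<circ> pmap_inv p) (ran p) (dom p)"
  proof (rule bij_betw_byWitness[where f' = "the \<circ> p"])
    have "pmap_inv p y = Some x" if "p x = Some y" for x y
      using that by simp
    then show "\<forall>a\<in>ran p. (the \<circ> p) ((the \<circ> pmap_inv p) a) = a"
      "\<forall>a'\<in>dom p. (the \<circ> pmap_inv p) ((the \<circ> p) a') = a'"
      "(the \<circ> pmap_inv p) ` ran p \<subseteq> dom p" "(the \<circ> p) ` dom p \<subseteq> ran p"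
      by (fastforce simp: ran_def dom_def simp del: pmap_inv_eq_Some_iff[OF p])+
  qed
  have "mdist X ((the \<circ> pmap_inv p) y) ((the \<circ> pmap_inv p) y') = mdist X y y'"
    if "y \<in> ran p" "y' \<in> ran p" for y y'
  proof -
    from that obtain x x' where x: "p x = Some y" "p x' = Some y'"
      unfolding ran_def by blast
    then have "pmap_inv p y = Some x" "pmap_inv p y' = Some x'"
      by simp_all
    then show ?thesis
      unfolding o_def by (simp only: d[OF x] option.sel)
  qed
  moreover have "finite (ran p)"
    using sub(3) by (rule finite_ran)
  ultimately show inv: "pmap_inv p \<in> partial_isometries X"
    using sub bij by (auto simp: partial_isometries_def isometry_def dr Int_absorb2)
  show "pmap_inv (pmap_inv p) = p"
  proof
    fix x
    have "pmap_inv (pmap_inv p) x = Some y \<longleftrightarrow> p x = Some y" for y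
      by (simp add: pmap_inv_eq_Some_iff[OF inv])
    then show "pmap_inv (pmap_inv p) x = p x"
      by (metis not_Some_eq)
  qed
qed

lemma pmap_inv_PIso: "pmap_inv \<in> PIso X \<rightarrow> PIso X"
proof
  fix p assume "p \<in> PIso X"
  then have p: "p \<in> partial_isometries X" "\<not> p \<subseteq>\<^sub>m Some"
    by (auto simp: PIso_def)
  then obtain x y where xy: "p x = Some y" "x \<noteq> y"
    by (auto simp: map_le_def dom_def)
  then have "pmap_inv p y = Some x"
    by (simp add: pmap_inv_eq_Some_iff[OF p(1)])
  with xy have "\<not> pmap_inv p \<subseteq>\<^sub>m Some"
    by (force simp: map_le_def dom_def)
  then show "pmap_inv p \<in> PIso X"
    using pmap_inv_partial_isometry(1)[OF p(1)] by (simp add: PIso_def)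
qed

lemma pmap_inv_involution: "\<forall>p\<in>PIso X. pmap_inv (pmap_inv p) = p"
  by (auto simp: PIso_def pmap_inv_partial_isometry(2))

lemma group_FPIso: "group (FPIso X)"
  unfolding FPIso_def by (rule group_free_group[OF pmap_inv_PIso pmap_inv_involution])

lemma S_extension_hom:
  assumes "S_extension X Y \<phi>"
  shows "free_lift (Iso Y) \<phi> \<in> hom (FPIso X) (Iso Y)"
  unfolding FPIso_def
  by (rule free_lift_hom[OF group_Iso pmap_inv_PIso pmap_inv_involution])
    (use assms in \<open>auto simp: S_extension_def\<close>)

end

theory Submission
  imports Defs
begin

text \<open>A Loewenheim-Skolem argument: each of the three clauses of ultraextensivity asks, for finite
  data in the subspace, for countably many further points of \<open>U\<close>, so a countable set closed under
  suitable choices exists. The only subtlety is that \<open>\<phi>\<^sub>1\<close> in the third clause ranges over functions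
  with arbitrary values outside \<open>\<P>\<close>; only the restrictions to \<open>\<P>\<close>, of which there are
  finitely many, matter.\<close>

text \<open>Adjoining \<open>c F\<close> for every finite subset \<open>F\<close> is iterated
  \<omega> times. Each stage stays countable because a countable set has only countably many finite
  subsets. The stages increase, so a finite subset of their union already lies in one stage, and the
  next stage absorbs its \<open>c F\<close>.\<close>

lemma countable_finitary_closure:
  assumes c: "\<And>F. finite F \<Longrightarrow> F \<subseteq> S \<Longrightarrow> countable (c F) \<and> c F \<subseteq> S"
    and X: "X \<subseteq> S" "countable X"
  shows "\<exists>Y. X \<subseteq> Y \<and> Y \<subseteq> S \<and> countable Y \<and> (\<forall>F. finite F \<longrightarrow> F \<subseteq> Y \<longrightarrow> c F \<subseteq> Y)"
proof -
  define step where "step A = A \<union> (\<Union>F\<in>{F. finite F \<and> F \<subseteq> A}. c F)" for A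
  define A where "A n = (step ^^ n) X" for n
  have A_Suc: "A (Suc n) = step (A n)" for n
    by (simp add: A_def)
  have A: "countable (A n) \<and> A n \<subseteq> S" for n
  proof (induction n)
    case 0
    then show ?case
      using X by (simp add: A_def)
  next
    case (Suc n)
    then have "countable {F. finite F \<and> F \<subseteq> A n}"
      by (simp add: countable_Collect_finite_subset)
    moreover have *: "countable (c F) \<and> c F \<subseteq> S" if "F \<in> {F. finite F \<and> F \<subseteq> A n}" for F
      using that Suc by (intro c) auto
    ultimately have "countable (\<Union>F\<in>{F. finite F \<and> F \<subseteq> A n}. c F)"
      by (intro countable_UN) simp_all
    moreover have "(\<Union>F\<in>{F. finite F \<and> F \<subseteq> A n}. c F) \<subseteq> S"
      using * by (intro UN_least) simp
    ultimately show ?case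
      using Suc unfolding A_Suc step_def by simp
  qed
  have mono: "mono A"
    by (rule monoI, rule lift_Suc_mono_le) (auto simp: A_Suc step_def)
  have "c F \<subseteq> (\<Union>n. A n)" if F: "finite F" "F \<subseteq> (\<Union>n. A n)" for F
  proof -
    have "\<exists>n. F \<subseteq> A n"
      using F
    proof (induction F)
      case (insert x F)
      then obtain m n where "F \<subseteq> A m" "x \<in> A n"
        by auto
      then have "insert x F \<subseteq> A (max m n)"
        using monoD[OF mono, of m "max m n"] monoD[OF mono, of n "max m n"] by auto
      then show ?case ..
    qed simp
    then obtain n where "F \<subseteq> A n" ..
    then have "c F \<subseteq> A (Suc n)"
      using F(1) by (auto simp: A_Suc step_def)
    then show ?thesis
      by blast
  qed
  moreover have "X \<subseteq> (\<Union>n. A n)"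
    using UN_upper[of 0 UNIV A] by (simp add: A_def)
  ultimately show ?thesis
    using A by (intro exI[of _ "\<Union>n. A n"] conjI UN_least countable_UN) auto
qed

lemma partial_isometries_submetric:
  "p \<in> partial_isometries (submetric U A) \<longleftrightarrow>
     p \<in> partial_isometries U \<and> dom p \<subseteq> A \<and> ran p \<subseteq> A"
proof (cases "dom p \<subseteq> A \<and> ran p \<subseteq> A")
  case True
  then have "submetric (submetric U A) (dom p) = submetric U (dom p)"
    "submetric (submetric U A) (ran p) = submetric U (ran p)"
    by (simp_all add: submetric_submetric Int_absorb1)
  with True show ?thesis
    by (auto simp: partial_isometries_def)
qed (auto simp: partial_isometries_def)

lemma finite_partial_isometries:
  assumes "finite (mspace X)"
  shows "finite (partial_isometries X)"
proof (rule finite_subset)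
  show "partial_isometries X \<subseteq> (\<Union>D\<in>Pow (mspace X). {p. dom p = D \<and> ran p \<subseteq> mspace X})"
    by (auto simp: partial_isometries_def)
  show "finite (\<Union>D\<in>Pow (mspace X). {p. dom p = D \<and> ran p \<subseteq> mspace X})"
    using assms by (auto intro!: finite_set_of_finite_maps dest: finite_subset)
qed

lemma finite_PIso: "finite (mspace X) \<Longrightarrow> finite (PIso X)"
  by (simp add: PIso_def finite_partial_isometries)

text \<open>Elements of \<open>Iso Y\<close> are \<open>undefined\<close> off the space, so they are
  determined by their values on \<open>mspace Y\<close>.\<close>

lemma finite_Iso:
  assumes "finite (mspace Y)"
  shows "finite (carrier (Iso Y))"
proof (rule finite_subset)
  show "carrier (Iso Y) \<subseteq> mspace Y \<rightarrow>\<^sub>E mspace Y"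
    by (auto simp: Iso_def Bij_def PiE_def bij_betw_def)
  show "finite (mspace Y \<rightarrow>\<^sub>E mspace Y)"
    using assms by (intro finite_PiE) auto
qed

lemma restrict_Iso_submetric:
  assumes f: "f \<in> carrier (Iso U)" and Y: "Y \<subseteq> mspace U" "f ` Y = Y"
  shows "restrict f Y \<in> carrier (Iso (submetric U Y))"
proof -
  have "inj_on f Y"
    using f Y(1) by (auto simp: Iso_def Bij_def bij_betw_def intro: inj_on_subset)
  then have "bij_betw f Y Y"
    using Y(2) by (simp add: bij_betw_def)
  moreover have "mdist U (f x) (f y) = mdist U x y" if "x \<in> Y" "y \<in> Y" for x y
    using f that Y(1) by (auto simp: Iso_def isometry_def)
  ultimately show ?thesis
    using Y(1) by (auto simp: Iso_def Bij_def isometry_def Int_absorb2 bij_betw_restrict_eq)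
qed

text \<open>Since \<open>i\<close> preserves \<open>S\<close>, every word in a class of the free
  group has its letters in \<open>S\<close>; values of the generator map elsewhere never
  enter.\<close>

lemma free_lift_cong:
  assumes i: "i \<in> S \<rightarrow> S" and \<phi>: "\<And>s. s \<in> S \<Longrightarrow> \<phi> s = \<psi> s" and g: "g \<in> carrier (free_group S i)"
  shows "free_lift G \<phi> g = free_lift G \<psi> g"
proof -
  have "word_val G \<phi> w = word_val G \<psi> w" if "w \<in> lists S" for w
    using that by (induction w) (auto simp: word_val_def \<phi>)
  moreover have "w \<in> lists S" if "w \<in> g" for w
    using g that by (auto elim!: free_group_carrierE dest: word_eq_lists[OF i])
  ultimately have "word_val G \<phi> ` g = word_val G \<psi> ` g"
    by (intro image_cong) auto
  then show ?thesis
    by (simp add: free_lift_def)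
qed

lemma free_lift_FPIso_restrict:
  "g \<in> carrier (FPIso X) \<Longrightarrow> free_lift G (restrict \<phi> (PIso X)) g = free_lift G \<phi> g"
  unfolding FPIso_def by (rule free_lift_cong[OF pmap_inv_PIso]) auto

text \<open>The definition also evaluates \<phi> at \<open>pmap_inv p\<close>, which again lies in
  \<open>PIso X\<close>; so all its arguments are in the set to which \<phi> is restricted.\<close>

lemma minimal_S_extension_restrict:
  "minimal_S_extension X Y (restrict \<phi> (PIso X)) \<longleftrightarrow> minimal_S_extension X Y \<phi>"
proof -
  have "S_extension X Y (restrict \<phi> (PIso X)) \<longleftrightarrow> S_extension X Y \<phi>"
    using pmap_inv_PIso[of X] unfolding S_extension_def by (auto simp: Pi_iff)
  then show ?thesis
    unfolding minimal_S_extension_def by (simp add: free_lift_FPIso_restrict)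
qed

lemma coherent_restrict:
  "coherent X1 Y1 (restrict \<phi>1 (PIso X1)) X2 Y2 \<phi>2 \<longleftrightarrow> coherent X1 Y1 \<phi>1 X2 Y2 \<phi>2"
proof -
  have "S_image X1 Y1 (restrict \<phi>1 (PIso X1)) = S_image X1 Y1 \<phi>1"
    unfolding S_image_def by (simp add: free_lift_FPIso_restrict cong: image_cong)
  then show ?thesis
    unfolding coherent_def by simp
qed

theorem theorem6p4:
  fixes U :: "'a metric" and X :: "'a set"
  assumes "ultraextensive U" and "X \<subseteq> mspace U" and "countable X"
  shows "\<exists>Y. Y \<subseteq> mspace U \<and> countable Y \<and> X \<subseteq> Y \<and> ultraextensive (submetric U Y)"
proof -
  let ?S = "mspace U" and ?M = "submetric U"
  have ext: "\<forall>p\<in>partial_isometries U. \<exists>f\<in>carrier (Iso U). \<forall>x\<in>dom p. p x = Some (f x)"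
    and S_ext: "\<forall>A. finite A \<and> A \<subseteq> ?S \<longrightarrow>
      (\<exists>B \<phi>. B \<subseteq> ?S \<and> finite B \<and> S_extension (?M A) (?M B) \<phi>)"
    and coh_ext: "\<forall>A B C \<phi>. finite A \<and> finite B \<and> A \<subseteq> B \<and> B \<subseteq> ?S \<and> C \<subseteq> ?S \<and> finite C \<and>
      minimal_S_extension (?M A) (?M C) \<phi> \<longrightarrow>
      (\<exists>D \<psi>. D \<subseteq> ?S \<and> finite D \<and> minimal_S_extension (?M B) (?M D) \<psi> \<and>
        coherent (?M A) (?M C) \<phi> (?M B) (?M D) \<psi>)"
    using assms(1) unfolding ultraextensive_def by - (elim conjE, assumption)+
  from bchoice[OF ext[unfolded Bex_def]] obtain f where
    "\<forall>p\<in>partial_isometries U. f p \<in> carrier (Iso U) \<and> (\<forall>x\<in>dom p. p x = Some (f p x))" ..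
  note f = bspec[OF this]
  have "\<forall>A\<in>{A. finite A \<and> A \<subseteq> ?S}. \<exists>B. B \<subseteq> ?S \<and> finite B \<and> (\<exists>\<phi>. S_extension (?M A) (?M B) \<phi>)"
    using S_ext by simp
  from bchoice[OF this] obtain E where "\<forall>A\<in>{A. finite A \<and> A \<subseteq> ?S}.
      E A \<subseteq> ?S \<and> finite (E A) \<and> (\<exists>\<phi>. S_extension (?M A) (?M (E A)) \<phi>)" ..
  then have E: "E A \<subseteq> ?S \<and> finite (E A) \<and> (\<exists>\<phi>. S_extension (?M A) (?M (E A)) \<phi>)"
    if "finite A" "A \<subseteq> ?S" for A
    using that by simp
  \<comment> \<open>The map \<psi> stays existentially quantified: only the points of
    \<open>D\<close> have to be put into the countable set.\<close>
  let ?ok = "\<lambda>A B C \<phi> D. D \<subseteq> ?S \<and> finite D \<and> (\<exists>\<psi>. minimal_S_extension (?M B) (?M D) \<psi> \<and>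
    coherent (?M A) (?M C) \<phi> (?M B) (?M D) \<psi>)"
  \<comment> \<open>The default \<open>{}\<close> makes \<open>H\<close> a finite subset of
    \<open>U\<close> for all arguments, so \<open>c3\<close> may take a union over data that are no
    S-extensions.\<close>
  define H where "H A B C \<phi> =
    (if \<exists>D. ?ok A B C \<phi> D then SOME D. ?ok A B C \<phi> D else {})" for A B C \<phi>
  have H_fin: "H A B C \<phi> \<subseteq> ?S \<and> finite (H A B C \<phi>)" for A B C \<phi>
    using someI_ex[of "?ok A B C \<phi>"] unfolding H_def by auto
  have H: "?ok A B C \<phi> (H A B C \<phi>)"
    if "finite A" "finite B" "A \<subseteq> B" "B \<subseteq> ?S" "C \<subseteq> ?S" "finite C"
      "minimal_S_extension (?M A) (?M C) \<phi>" for A B C \<phi>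
  proof -
    have ex: "\<exists>D. ?ok A B C \<phi> D"
      using coh_ext[rule_format, of A B C \<phi>] that by blast
    then show ?thesis
      using someI_ex[OF ex] by (simp add: H_def)
  qed
  \<comment> \<open>Preimages under \<open>f p\<close> are added along with images, so that
    \<open>f p\<close> will map the closed set onto itself and not just into it.\<close>
  define c1 where "c1 F = (\<Union>p\<in>partial_isometries (?M F). f p ` F \<union> inv_into ?S (f p) ` F)" for F
  \<comment> \<open>Extensional \<phi> suffice, and for finite \<open>F\<close> there are finitely
    many: both \<open>PIso (?M A)\<close> and the isometry group of \<open>?M C\<close> are
    finite.\<close>
  define c3 where "c3 F = (\<Union>A\<in>Pow F. \<Union>B\<in>Pow F. \<Union>C\<in>Pow F.
    \<Union>\<phi>\<in>PIso (?M A) \<rightarrow>\<^sub>E carrier (Iso (?M C)). H A B C \<phi>)" for F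
  have bij: "bij_betw (f p) ?S ?S" if "p \<in> partial_isometries U" for p
    using f[OF that] by (simp add: Iso_def Bij_def)
  have c: "countable (c1 F \<union> E F \<union> c3 F) \<and> c1 F \<union> E F \<union> c3 F \<subseteq> ?S"
    if F: "finite F" "F \<subseteq> ?S" for F
  proof -
    have "finite (c1 F)"
      using F(1) unfolding c1_def by (auto intro!: finite_partial_isometries)
    moreover have "c1 F \<subseteq> ?S"
    proof -
      have "f p x \<in> ?S \<and> inv_into ?S (f p) x \<in> ?S"
        if "p \<in> partial_isometries U" "x \<in> F" for p x
        using bij[OF that(1)] F(2) that(2)
        by (metis bij_betw_apply bij_betw_inv_into subsetD)
      then show ?thesis
        unfolding c1_def by (auto simp: partial_isometries_submetric)
    qed
    moreover have "finite (c3 F)"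
    proof -
      have "finite (PIso (?M A) \<rightarrow>\<^sub>E carrier (Iso (?M C)))" if "A \<subseteq> F" "C \<subseteq> F" for A C
        using that F(1)
        by (intro finite_PiE finite_Iso finite_PIso) (auto dest: finite_subset)
      then show ?thesis
        unfolding c3_def using F(1) H_fin by (intro finite_UN_I) auto
    qed
    moreover have "c3 F \<subseteq> ?S"
      unfolding c3_def using H_fin by blast
    ultimately show ?thesis
      using E[OF F] by (simp add: countable_finite)
  qed
  have "\<exists>Y. X \<subseteq> Y \<and> Y \<subseteq> ?S \<and> countable Y \<and>
      (\<forall>F. finite F \<longrightarrow> F \<subseteq> Y \<longrightarrow> c1 F \<union> E F \<union> c3 F \<subseteq> Y)"
    by (rule countable_finitary_closure[OF _ assms(2,3)]) (rule c)
  then obtain Y where Y: "X \<subseteq> Y" "Y \<subseteq> ?S" "countable Y"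
    and "\<forall>F. finite F \<longrightarrow> F \<subseteq> Y \<longrightarrow> c1 F \<union> E F \<union> c3 F \<subseteq> Y"
    by (elim exE conjE)
  note closed = this(4)[rule_format]
  \<comment> \<open>A subset of \<open>Y\<close> carries the same metric whether taken in
    \<open>Y\<close> or in \<open>U\<close>, so extensions chosen in \<open>U\<close> serve in
    \<open>Y\<close> once their points lie in \<open>Y\<close>.\<close>
  have sub: "submetric (?M Y) A = ?M A" if "A \<subseteq> Y" for A
    using that by (simp add: submetric_submetric Int_absorb1)
  have mY: "mspace (?M Y) = Y"
    using Y(2) by auto
  have "ultraextensive (?M Y)"
    unfolding ultraextensive_def mY
  proof (intro conjI allI impI ballI)
    fix p assume "p \<in> partial_isometries (?M Y)"
    then have p: "p \<in> partial_isometries U" "dom p \<subseteq> Y" "ran p \<subseteq> Y"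
      by (auto simp: partial_isometries_submetric)
    have clos: "f p y \<in> Y \<and> inv_into ?S (f p) y \<in> Y" if "y \<in> Y" for y
    proof -
      \<comment> \<open>\<open>c1 ?F\<close> only uses partial isometries living inside
        \<open>?F\<close>, so \<open>?F\<close> must contain the domain and range of
        \<open>p\<close> besides the point \<open>y\<close>.\<close>
      let ?F = "insert y (dom p \<union> ran p)"
      have "finite (dom p)"
        using p(1) by (simp add: partial_isometries_def)
      then have "c1 ?F \<subseteq> Y"
        using closed[of ?F] p that by (simp add: finite_ran)
      moreover have "p \<in> partial_isometries (?M ?F)"
        using p by (auto simp: partial_isometries_submetric)
      ultimately show ?thesis
        unfolding c1_def by blast
    qed
    have "f p ` Y = Y"
    proof
      show "f p ` Y \<subseteq> Y"
        using clos by blast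
      have "f p (inv_into ?S (f p) y) = y" if "y \<in> Y" for y
        using bij[OF p(1)] Y(2) that by (metis bij_betw_inv_into_right subsetD)
      then show "Y \<subseteq> f p ` Y"
        using clos by (metis image_eqI subsetI)
    qed
    then have "restrict (f p) Y \<in> carrier (Iso (?M Y))"
      using f[OF p(1)] Y(2) by (simp add: restrict_Iso_submetric)
    moreover have "\<forall>x\<in>dom p. p x = Some (restrict (f p) Y x)"
      using f[OF p(1)] p(2) by (metis restrict_apply' subsetD)
    ultimately show "\<exists>g\<in>carrier (Iso (?M Y)). \<forall>x\<in>dom p. p x = Some (g x)"
      by blast
  next
    fix A assume A: "finite A \<and> A \<subseteq> Y"
    then have "E A \<subseteq> Y"
      using closed[of A] by blast
    moreover have "finite (E A)" "\<exists>\<phi>. S_extension (?M A) (?M (E A)) \<phi>"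
      using E[of A] A Y(2) by auto
    ultimately show "\<exists>B \<phi>. B \<subseteq> Y \<and> finite B \<and>
        S_extension (submetric (?M Y) A) (submetric (?M Y) B) \<phi>"
      using A by (auto simp only: sub intro!: exI[of _ "E A"])
  next
    fix A B C \<phi>
    assume *: "finite A \<and> finite B \<and> A \<subseteq> B \<and> B \<subseteq> Y \<and> C \<subseteq> Y \<and> finite C \<and>
      minimal_S_extension (submetric (?M Y) A) (submetric (?M Y) C) \<phi>"
    then have fin: "finite A" "finite B" "A \<subseteq> B" "B \<subseteq> ?S" "C \<subseteq> ?S" "finite C"
      and ABC: "A \<subseteq> Y" "B \<subseteq> Y" "C \<subseteq> Y"
      using Y(2) by auto
    \<comment> \<open>The given \<phi> may be arbitrary off \<open>PIso (?M A)\<close> and so need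
      not be an index in \<open>c3\<close>; its restriction is one. The extension is chosen for
      \<phi>' and carried back to \<phi>.\<close>
    define \<phi>' where "\<phi>' = restrict \<phi> (PIso (?M A))"
    have min: "minimal_S_extension (?M A) (?M C) \<phi>"
      using * unfolding sub[OF ABC(1)] sub[OF ABC(3)] by blast
    then have "?ok A B C \<phi>' (H A B C \<phi>')"
      unfolding \<phi>'_def by (intro H fin) (simp add: minimal_S_extension_restrict)
    then obtain \<psi> where "finite (H A B C \<phi>')"
      and \<psi>: "minimal_S_extension (?M B) (?M (H A B C \<phi>')) \<psi>"
        "coherent (?M A) (?M C) \<phi> (?M B) (?M (H A B C \<phi>')) \<psi>"
      by (auto simp: \<phi>'_def coherent_restrict)
    moreover have HY: "H A B C \<phi>' \<subseteq> Y"
    proof -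
      have "\<phi>' \<in> PIso (?M A) \<rightarrow>\<^sub>E carrier (Iso (?M C))"
        using min unfolding \<phi>'_def minimal_S_extension_def S_extension_def
        by (simp add: restrict_PiE_iff Pi_iff)
      \<comment> \<open>\<open>B \<union> C\<close> also contains \<open>A\<close>, as
        \<open>A \<subseteq> B\<close>, so all three sets are among the subsets over which
        \<open>c3\<close> takes its union.\<close>
      then have "H A B C \<phi>' \<subseteq> c3 (B \<union> C)"
        using fin(3) unfolding c3_def by blast
      also have "\<dots> \<subseteq> Y"
        using closed[of "B \<union> C"] fin ABC by simp
      finally show ?thesis .
    qed
    ultimately show "\<exists>D \<psi>. D \<subseteq> Y \<and> finite D \<and>
        minimal_S_extension (submetric (?M Y) B) (submetric (?M Y) D) \<psi> \<and>
        coherent (submetric (?M Y) A) (submetric (?M Y) C) \<phi>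
          (submetric (?M Y) B) (submetric (?M Y) D) \<psi>"
      unfolding sub[OF ABC(1)] sub[OF ABC(2)] sub[OF ABC(3)]
      by (intro exI[of _ "H A B C \<phi>'"] exI[of _ \<psi>]) (simp only: sub[OF HY] simp_thms)
  qed
  with Y show ?thesis
    by blast
qed

end
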